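(* For integers $N,n,i,j\ge0$ and $m\in\{1,2\}$, $D^{\mathrm{I}}_{m,3N}(i,j,n)=D^{\mathrm{II}}_{m,3N}(i,j,n)$.
   Context: For a partition into distinct parts $\pi=(\pi_1>\pi_2>\cdots)$, odd-indexed parts are $\pi_1,\pi_3,\dots$ and even-indexed parts are $\pi_2,\pi_4,\dots$. $D^{\mathrm{I}}_{m,3N}(i,j,n)$ is the number of partitions of $n$ into distinct parts such that: (i) each part is $\not\equiv -m\pmod3$; (ii) each part is $\le 3N$; (iii) exactly $i$ odd-indexed parts are $\equiv m\pmod3$; (iv) exactly $j$ even-indexed parts are $\equiv m\pmod3$. $D^{\mathrm{II}}_{m,3N}(i,j,n)$ is the number of partitions of $n$ into distinct parts such that: (i) each part is $\not\equiv-m\pmod3$; (ii) there are exactly $i$ parts $\equiv m\pmod6$, all $\le 6N+m-6$; (iii) there are exactly $j$ parts $\equiv m+3\pmod6$, all $\le 6(N-i)+m-3$; (iv) all parts $\equiv0\pmod3$ are $\le 3(N-i-j)$. *)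

theory Defs
  imports "HOL-Number_Theory.Cong"
begin

text \<open>A partition into distinct parts is the list of its parts in strictly decreasing order,
  so the part $\pi_k$ is the list entry at position $k - 1$.\<close>

definition distinct_partitions :: "nat \<Rightarrow> nat list set" where
  "distinct_partitions n =
     {\<pi>. sorted_wrt (>) \<pi> \<and> (\<forall>p\<in>set \<pi>. 0 < p) \<and> sum_list \<pi> = n}"

lemma finite_distinct_partitions: "finite (distinct_partitions n)"
proof (rule finite_subset)
  have "length xs \<le> sum_list xs" if "\<forall>p\<in>set xs. 0 < p" for xs :: "nat list"
    using that by (induction xs) auto
  then show "distinct_partitions n \<subseteq> {xs. set xs \<subseteq> {..n} \<and> length xs \<le> n}"
    by (auto simp: distinct_partitions_def intro: member_le_sum_list)
  show "finite {xs. set xs \<subseteq> {..n} \<and> length xs \<le> n}"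
    by (rule finite_lists_length_le) simp
qed

text \<open>List positions start at 0, so the odd-indexed parts $\pi_1, \pi_3, \ldots$ sit at the
  even positions.\<close>

definition odd_indexed_count :: "nat list \<Rightarrow> (nat \<Rightarrow> bool) \<Rightarrow> nat" where
  "odd_indexed_count \<pi> P = card {k. k < length \<pi> \<and> even k \<and> P (\<pi> ! k)}"

definition even_indexed_count :: "nat list \<Rightarrow> (nat \<Rightarrow> bool) \<Rightarrow> nat" where
  "even_indexed_count \<pi> P = card {k. k < length \<pi> \<and> odd k \<and> P (\<pi> ! k)}"

text \<open>In both definitions the argument \<open>N\<close> stands for the subscript $3N$.\<close>

definition D_I :: "nat \<Rightarrow> nat \<Rightarrow> nat \<Rightarrow> nat \<Rightarrow> nat \<Rightarrow> nat" where
  "D_I m N i j n = card {\<pi> \<in> distinct_partitions n.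
     (\<forall>p\<in>set \<pi>. \<not> [int p = - int m] (mod 3)) \<and>
     (\<forall>p\<in>set \<pi>. p \<le> 3 * N) \<and>
     odd_indexed_count \<pi> (\<lambda>p. [p = m] (mod 3)) = i \<and>
     even_indexed_count \<pi> (\<lambda>p. [p = m] (mod 3)) = j}"

text \<open>The bounds on the parts may be negative, so they are taken in the integers.\<close>

definition D_II :: "nat \<Rightarrow> nat \<Rightarrow> nat \<Rightarrow> nat \<Rightarrow> nat \<Rightarrow> nat" where
  "D_II m N i j n = card {\<pi> \<in> distinct_partitions n.
     (\<forall>p\<in>set \<pi>. \<not> [int p = - int m] (mod 3)) \<and>
     card {p \<in> set \<pi>. [p = m] (mod 6)} = i \<and>
     (\<forall>p\<in>set \<pi>. [p = m] (mod 6) \<longrightarrow> int p \<le> 6 * int N + int m - 6) \<and>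
     card {p \<in> set \<pi>. [p = m + 3] (mod 6)} = j \<and>
     (\<forall>p\<in>set \<pi>. [p = m + 3] (mod 6) \<longrightarrow> int p \<le> 6 * (int N - int i) + int m - 3) \<and>
     (\<forall>p\<in>set \<pi>. [p = 0] (mod 3) \<longrightarrow> int p \<le> 3 * (int N - int i - int j))}"

end

theory Submission
  imports Defs "HOL-Computational_Algebra.Polynomial"
begin

text \<open>Both sides are compared through generating functions in a variable \<open>x\<close>, with \<open>i\<close>, \<open>j\<close> and \<open>N\<close>
  fixed. On side I, splitting off the parts \<open>3N\<close> and \<open>3(N - 1) + m\<close> (each removed part exchanges
  the roles of odd and even positions) gives
  \<open>F\<^bsub>N+1\<^esub>(i,j) = F\<^bsub>N\<^esub>(i,j) + x\<^bsup>3N+3\<^esup> F\<^bsub>N\<^esub>(j,i) + x\<^bsup>3N+m\<^esup> F\<^bsub>N\<^esub>(j,i-1) + x\<^bsup>6N+3+m\<^esup> F\<^bsub>N\<^esub>(i,j-1)\<close>,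
  and induction on \<open>N\<close> shows that \<open>F\<^bsub>N\<^esub>(i,j)\<close> is a monomial times
  \<open>(x\<^sup>6;x\<^sup>6)\<^bsub>N\<^esub> / ((x\<^sup>6;x\<^sup>6)\<^bsub>i\<^esub> (x\<^sup>6;x\<^sup>6)\<^bsub>j\<^esub> (x\<^sup>3;x\<^sup>3)\<^bsub>N-i-j\<^esub>)\<close>. On side II the three residue classes are
  independent, which gives a product of two Gaussian binomials in \<open>x\<^sup>6\<close> and
  \<open>(-x\<^sup>3;x\<^sup>3)\<^bsub>N-i-j\<^esub>\<close>, equal to the same quotient.\<close>

subsection \<open>Counting by position in decreasing lists\<close>

definition decreasing_lists :: "nat set \<Rightarrow> (nat \<Rightarrow> bool) \<Rightarrow> nat \<Rightarrow> nat \<Rightarrow> nat list set" where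
  "decreasing_lists S P i j = {\<pi>. sorted_wrt (>) \<pi> \<and> set \<pi> \<subseteq> S \<and>
     odd_indexed_count \<pi> P = i \<and> even_indexed_count \<pi> P = j}"

definition list_gf :: "'a::comm_semiring_1 \<Rightarrow> nat list set \<Rightarrow> 'a" where
  "list_gf x A = (\<Sum>\<pi>\<in>A. x ^ sum_list \<pi>)"

lemma odd_indexed_count_Nil [simp]: "odd_indexed_count [] P = 0"
  and even_indexed_count_Nil [simp]: "even_indexed_count [] P = 0"
  by (simp_all add: odd_indexed_count_def even_indexed_count_def)

text \<open>Prepending a part moves every old position up by one, so the parity classes change
  places; the new head sits at position 0 and never counts here.\<close>

lemma even_indexed_count_Cons [simp]:
  "even_indexed_count (p # \<pi>) P = odd_indexed_count \<pi> P"
proof -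
  have "{k. k < length (p # \<pi>) \<and> odd k \<and> P ((p # \<pi>) ! k)}
      = Suc ` {k. k < length \<pi> \<and> even k \<and> P (\<pi> ! k)}"
    by (auto simp: image_iff gr0_conv_Suc nth_Cons split: nat.splits elim: oddE)
  then show ?thesis
    by (simp add: odd_indexed_count_def even_indexed_count_def card_image)
qed

lemma odd_indexed_count_Cons [simp]:
  "odd_indexed_count (p # \<pi>) P = (if P p then 1 else 0) + even_indexed_count \<pi> P"
proof -
  have "{k. k < length (p # \<pi>) \<and> even k \<and> P ((p # \<pi>) ! k)}
      = (if P p then {0} else {}) \<union> Suc ` {k. k < length \<pi> \<and> odd k \<and> P (\<pi> ! k)}"
    (is "?L = ?R")
  proof (rule set_eqI)
    show "k \<in> ?L \<longleftrightarrow> k \<in> ?R" for k by (cases k) auto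
  qed
  then show ?thesis
    by (simp add: odd_indexed_count_def even_indexed_count_def card_image card_insert_if image_iff)
qed

lemma distinct_if_sorted_wrt_greater: "sorted_wrt (>) (xs :: nat list) \<Longrightarrow> distinct xs"
  by (induction xs) auto

lemma finite_sorted_lists:
  assumes "finite (S :: nat set)"
  shows "finite {\<pi>. sorted_wrt (>) \<pi> \<and> set \<pi> \<subseteq> S}"
proof (rule finite_subset)
  show "{\<pi>. sorted_wrt (>) \<pi> \<and> set \<pi> \<subseteq> S} \<subseteq> {\<pi>. set \<pi> \<subseteq> S \<and> length \<pi> \<le> card S}"
  proof safe
    fix \<pi> assume \<pi>: "sorted_wrt (>) \<pi>" "set \<pi> \<subseteq> S"
    then have "distinct \<pi>"
      by (simp add: distinct_if_sorted_wrt_greater)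
    with \<pi> show "length \<pi> \<le> card S"
      by (metis assms card_mono distinct_card)
  qed
  show "finite {\<pi>. set \<pi> \<subseteq> S \<and> length \<pi> \<le> card S}"
    by (rule finite_lists_length_le[OF assms])
qed

lemma finite_decreasing_lists: "finite S \<Longrightarrow> finite (decreasing_lists S P i j)"
  by (rule finite_subset[OF _ finite_sorted_lists[of S]]) (auto simp: decreasing_lists_def)

lemma decreasing_lists_empty:
  "decreasing_lists {} P i j = (if i = 0 \<and> j = 0 then {[]} else {})"
  by (auto simp: decreasing_lists_def)

text \<open>An element above all of \<open>S\<close> can occur only as the head. Removing it swaps
  the two counts, hence \<open>j\<close> before \<open>i\<close>. A head satisfying \<open>P\<close>
  takes one off \<open>i\<close>; the case \<open>i = 0\<close> is separate because
  \<open>i - 1\<close> would truncate.\<close>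

lemma decreasing_lists_insert:
  assumes "\<And>s. s \<in> S \<Longrightarrow> s < p"
  shows "decreasing_lists (insert p S) P i j = decreasing_lists S P i j \<union>
    (if P p then if i = 0 then {} else (#) p ` decreasing_lists S P j (i - 1)
     else (#) p ` decreasing_lists S P j i)" (is "?L = ?A \<union> ?B")
proof (rule set_eqI)
  fix \<pi>
  show "\<pi> \<in> ?L \<longleftrightarrow> \<pi> \<in> ?A \<union> ?B"
  proof (cases \<pi>)
    case Nil
    then show ?thesis by (auto simp: decreasing_lists_def)
  next
    case (Cons q \<sigma>)
    have "p \<notin> S" using assms by blast
    \<comment> \<open>The entries of the tail lie strictly below the head \<open>r\<close>, and
      \<open>r\<close> is at most \<open>p\<close>.\<close>
    have "p \<notin> set \<sigma>" if "r \<in> insert p S" "\<forall>t\<in>set \<sigma>. t < r" for r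
      using that assms by (metis insert_iff less_asym less_irrefl)
    then have "q \<in> insert p S \<and> set \<sigma> \<subseteq> insert p S \<and> (\<forall>r\<in>set \<sigma>. r < q) \<longleftrightarrow>
      (q \<in> S \<and> set \<sigma> \<subseteq> S \<and> (\<forall>r\<in>set \<sigma>. r < q)) \<or> (q = p \<and> set \<sigma> \<subseteq> S)"
      using assms by blast
    then have "\<pi> \<in> ?L \<longleftrightarrow> \<pi> \<in> ?A \<or> q = p \<and> sorted_wrt (>) \<sigma> \<and> set \<sigma> \<subseteq> S \<and>
        (if P p then 1 else 0) + even_indexed_count \<sigma> P = i \<and> odd_indexed_count \<sigma> P = j"
      using Cons assms unfolding decreasing_lists_def by simp blast
    also have "\<dots> \<longleftrightarrow> \<pi> \<in> ?A \<union> ?B"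
      using Cons by (cases i) (auto simp: decreasing_lists_def)
    finally show ?thesis .
  qed
qed

lemma list_gf_Cons_image: "list_gf x ((#) p ` A) = x ^ p * list_gf x A"
  by (simp add: list_gf_def sum.reindex power_add sum_distrib_left)

lemma list_gf_decreasing_insert:
  assumes "\<And>s. s \<in> S \<Longrightarrow> s < p" and "finite S"
  shows "list_gf x (decreasing_lists (insert p S) P i j) = list_gf x (decreasing_lists S P i j) +
    (if P p then if i = 0 then 0 else x ^ p * list_gf x (decreasing_lists S P j (i - 1))
     else x ^ p * list_gf x (decreasing_lists S P j i))"
proof -
  let ?B = "if P p then if i = 0 then {} else (#) p ` decreasing_lists S P j (i - 1)
     else (#) p ` decreasing_lists S P j i"
  have "p \<notin> S" using assms by blast
  then have "p # \<sigma> \<notin> decreasing_lists S P i j" for \<sigma>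
    by (simp add: decreasing_lists_def)
  then have disj: "decreasing_lists S P i j \<inter> ?B = {}"
    by auto
  have fin: "finite (decreasing_lists S P i' j')" for i' j'
    using assms(2) by (rule finite_decreasing_lists)
  then have "finite ?B"
    by simp
  then have "list_gf x (decreasing_lists S P i j \<union> ?B)
      = list_gf x (decreasing_lists S P i j) + list_gf x ?B"
    unfolding list_gf_def by (intro sum.union_disjoint fin disj)
  moreover have "list_gf x ?B =
    (if P p then if i = 0 then 0 else x ^ p * list_gf x (decreasing_lists S P j (i - 1))
     else x ^ p * list_gf x (decreasing_lists S P j i))"
    by (simp add: list_gf_Cons_image) (simp add: list_gf_def)
  ultimately show ?thesis
    by (simp add: decreasing_lists_insert[OF assms(1)])
qed

section \<open>Admissible parts on side I and the recurrence in \<open>N\<close>\<close>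

definition I_parts :: "nat \<Rightarrow> nat \<Rightarrow> nat set" where
  "I_parts m N = {p. 0 < p \<and> \<not> [int p = - int m] (mod 3) \<and> p \<le> 3 * N}"

text \<open>The congruence says that 3 divides \<open>p + m\<close>, which moves the condition from
  the integers to remainders of naturals.\<close>

lemma part_residue:
  assumes "m \<in> {1, 2 :: nat}"
  shows "\<not> [int p = - int m] (mod 3) \<longleftrightarrow> p mod 3 = 0 \<or> p mod 3 = m"
proof -
  have "[int p = - int m] (mod 3) \<longleftrightarrow> int 3 dvd int (p + m)"
    by (simp add: cong_iff_dvd_diff)
  also have "\<dots> \<longleftrightarrow> 3 dvd p + m"
    by (rule int_dvd_int_iff)
  finally have "[int p = - int m] (mod 3) \<longleftrightarrow> (p + m) mod 3 = 0"
    by (simp only: dvd_eq_mod_eq_0)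
  moreover have "m = 1 \<or> m = 2" using assms by simp
  ultimately show ?thesis by presburger
qed

lemma I_parts_0: "I_parts m 0 = {}"
  by (auto simp: I_parts_def)

lemma I_parts_Suc:
  assumes "m \<in> {1, 2}"
  shows "I_parts m (Suc N) = insert (3 * N + 3) (insert (3 * N + m) (I_parts m N))"
proof -
  have le: "p \<le> 3 * Suc N \<longleftrightarrow> p \<le> 3 * N \<or> p = 3 * N + 1 \<or> p = 3 * N + 2 \<or> p = 3 * N + 3" for p
    by auto
  have "(3 * N + 1) mod 3 = 1" "(3 * N + 2) mod 3 = 2" "(3 * N + 3) mod 3 = 0"
    by presburger+
  moreover have "m = 1 \<or> m = 2" using assms by simp
  ultimately show ?thesis
    unfolding I_parts_def part_residue[OF assms] le by auto
qed

definition I_gf :: "'a::comm_semiring_1 \<Rightarrow> nat \<Rightarrow> nat \<Rightarrow> nat \<Rightarrow> nat \<Rightarrow> 'a" where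
  "I_gf x m N i j = list_gf x (decreasing_lists (I_parts m N) (\<lambda>p. [p = m] (mod 3)) i j)"

lemma I_gf_0: "I_gf x m 0 i j = (if i = 0 \<and> j = 0 then 1 else 0)"
  by (simp add: I_gf_def I_parts_0 decreasing_lists_empty list_gf_def)

text \<open>The four terms correspond to using neither new part, only \<open>3 * N + 3\<close>, only
  \<open>3 * N + m\<close>, or both. A single new head swaps \<open>i\<close> and \<open>j\<close>.
  With both, the swaps cancel and \<open>3 * N + m\<close> stands second, so it lowers
  \<open>j\<close>.\<close>

lemma I_gf_Suc:
  assumes "m \<in> {1, 2}"
  shows "I_gf x m (Suc N) i j = I_gf x m N i j + x ^ (3 * N + 3) * I_gf x m N j i
    + (if i = 0 then 0 else x ^ (3 * N + m) * I_gf x m N j (i - 1))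
    + (if j = 0 then 0 else x ^ (6 * N + 3 + m) * I_gf x m N i (j - 1))"
proof -
  have fin: "finite (I_parts m N)"
    by (rule finite_subset[of _ "{..3 * N}"]) (auto simp: I_parts_def)
  have 1: "s < 3 * N + m" if "s \<in> I_parts m N" for s
    using that assms by (auto simp: I_parts_def)
  have 2: "s < 3 * N + 3" if "s \<in> insert (3 * N + m) (I_parts m N)" for s
    using that assms by (auto simp: I_parts_def)
  have c: "[3 * N + m = m] (mod 3)" "\<not> [3 * N + 3 = m] (mod 3)"
    using assms by (auto simp: cong_def)
  have e: "x ^ (6 * N + 3 + m) = x ^ (3 * N + 3) * x ^ (3 * N + m)"
    by (simp add: power_add[symmetric] add.assoc)
  show ?thesis
    unfolding I_gf_def I_parts_Suc[OF assms]
    apply (subst list_gf_decreasing_insert[OF 2])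
      apply (simp_all add: fin list_gf_decreasing_insert[OF 1 fin] c e)
    apply (simp add: algebra_simps)
    done
qed

subsection \<open>The closed form for side I\<close>

text \<open>The finite product \<open>(y;y)\<^bsub>n\<^esub>\<close>.\<close>

definition qfact :: "'a::comm_ring_1 \<Rightarrow> nat \<Rightarrow> 'a" where
  "qfact y n = (\<Prod>k<n. 1 - y ^ Suc k)"

lemma qfact_0 [simp]: "qfact y 0 = 1"
  by (simp add: qfact_def)

lemma qfact_Suc: "qfact y (Suc n) = qfact y n * (1 - y ^ Suc n)"
  by (simp add: qfact_def)

text \<open>Allows denominators to be cancelled in an integral domain when \<open>y\<close> is not a
  root of unity.\<close>

lemma qfact_nonzero:
  fixes y :: "'a::idom"
  assumes "\<And>k. 0 < k \<Longrightarrow> y ^ k \<noteq> 1"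
  shows "qfact y n \<noteq> 0"
  using assms by (auto simp: qfact_def simp del: power_Suc)

text \<open>Difference of squares in each factor. It later absorbs the product coming from the
  multiples of 3 on side II.\<close>

lemma qfact_square:
  "qfact (y ^ 2) n = qfact y n * (\<Prod>k<n. 1 + y ^ Suc k)"
proof (induction n)
  case (Suc n)
  have "1 - (y ^ 2) ^ Suc n = (1 - y ^ Suc n) * (1 + y ^ Suc n)"
    by (simp add: algebra_simps power_mult_distrib power2_eq_square del: power_Suc)
  then show ?case
    using Suc by (simp add: qfact_Suc mult_ac del: power_Suc)
qed simp

text \<open>For \<open>i + j \<le> N\<close> this is the least sum on either side. On side II it is
  attained by \<open>m, m + 6, ...\<close> (\<open>i\<close> terms) together with
  \<open>m + 3, m + 9, ...\<close> (\<open>j\<close> terms).\<close>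

definition closed_exp :: "nat \<Rightarrow> nat \<Rightarrow> nat \<Rightarrow> nat" where
  "closed_exp m i j = m * (i + j) + 3 * (i * (i - 1) + j * j)"

text \<open>This and the next two identities match the exponents of the last three terms of
  \<open>I_gf_Suc\<close>; they are kept additive to avoid subtraction.\<close>

lemma closed_exp_swap: "closed_exp m j i + 3 * j = closed_exp m i j + 3 * i"
  unfolding closed_exp_def by (cases i; cases j; simp add: algebra_simps)

lemma closed_exp_Suc_left: "closed_exp m (Suc i) j = closed_exp m j i + 3 * (i + j) + m"
  unfolding closed_exp_def by (cases j) (simp_all add: algebra_simps)

lemma closed_exp_Suc_right: "closed_exp m i (Suc j) = closed_exp m i j + 6 * j + 3 + m"
  unfolding closed_exp_def by (simp add: algebra_simps)

text \<open>Each term of the recurrence lowers \<open>i + j\<close> by at most one, so the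
  inequality survives the step. This is the range outside the closed form.\<close>

lemma I_gf_eq_0:
  assumes "m \<in> {1, 2}" "N < i + j"
  shows "I_gf x m N i j = 0"
  using assms(2)
proof (induction N arbitrary: i j)
  case 0
  then show ?case by (auto simp: I_gf_0)
next
  case (Suc N)
  then show ?case by (auto simp: I_gf_Suc[OF assms(1)])
qed

text \<open>The quotient is stated with denominators multiplied out. In the step each term of the
  recurrence becomes \<open>T\<close> times a polynomial in \<open>a\<close>, \<open>b\<close>,
  \<open>c\<close>, and these polynomials add up to the new factor of
  \<open>qfact (x ^ 6) (Suc N)\<close>.\<close>

lemma I_gf_closed_form:
  fixes x :: "'a::idom"
  assumes m: "m \<in> {1, 2}" and "N = i + j + M"
  shows "I_gf x m N i j * (qfact (x ^ 6) i * qfact (x ^ 6) j * qfact (x ^ 3) M)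
    = x ^ closed_exp m i j * qfact (x ^ 6) N"
  using assms(2)
proof (induction N arbitrary: i j M)
  case 0
  then show ?case by (simp add: I_gf_0 closed_exp_def)
next
  case (Suc N)
  define K where "K i j = qfact (x ^ 6) i * qfact (x ^ 6) j" for i j
  define T where "T = x ^ closed_exp m i j * qfact (x ^ 6) N"
  define a where "a = x ^ (3 * i)"
  define b where "b = x ^ (3 * j)"
  define c where "c = x ^ (3 * M)"
  have N: "N = i + j + M - 1" "0 < i + j + M" using Suc.prems by auto
  have pow: "(x ^ 6) ^ n = (x ^ (3 * n)) ^ 2" "(x ^ 3) ^ n = x ^ (3 * n)" for n
    by (simp_all flip: power_mult)
  have IH: "I_gf x m N i' j' * (K i' j' * qfact (x ^ 3) M')
      = x ^ closed_exp m i' j' * qfact (x ^ 6) N" if "N = i' + j' + M'" for i' j' M'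
    using Suc.IH[OF that] by (simp add: K_def)
  \<comment> \<open>Both \<open>(i, j)\<close> and \<open>(j, i)\<close> need the hypothesis at
    \<open>M - 1\<close>; the missing last factor of \<open>qfact (x ^ 3) M\<close> is
    \<open>1 - c\<close>. For \<open>M = 0\<close> that factor is zero, and so is
    \<open>I_gf\<close>, since \<open>N < i' + j'\<close>.\<close>
  have T12: "I_gf x m N i' j' * (K i' j' * qfact (x ^ 3) M)
      = x ^ closed_exp m i' j' * qfact (x ^ 6) N * (1 - c)" if "i' + j' = i + j" for i' j'
  proof (cases M)
    case 0
    then show ?thesis
      using that N by (simp add: I_gf_eq_0[OF m] c_def)
  next
    case (Suc M')
    then show ?thesis
      using IH[of i' j' M'] that N
      by (simp add: qfact_Suc c_def pow mult_ac del: power_Suc mult_Suc_right)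
  qed
  have T1: "I_gf x m N i j * (K i j * qfact (x ^ 3) M) = T * (1 - c)"
    by (simp add: T12 T_def)
  have "x ^ (3 * N + 3) * (I_gf x m N j i * (K j i * qfact (x ^ 3) M))
      = (x ^ (3 * N + 3) * x ^ closed_exp m j i) * qfact (x ^ 6) N * (1 - c)"
    by (simp only: T12[of j i, OF add.commute] mult.assoc)
  also have "x ^ (3 * N + 3) * x ^ closed_exp m j i = x ^ closed_exp m i j * (a ^ 2 * c)"
  proof -
    have "3 * N + 3 + closed_exp m j i = closed_exp m i j + (3 * i * 2 + 3 * M)"
      using closed_exp_swap[of m j i] N by linarith
    then show ?thesis
      unfolding a_def c_def by (simp only: power_mult[symmetric] power_add[symmetric])
  qed
  finally have T2: "x ^ (3 * N + 3) * I_gf x m N j i * (K i j * qfact (x ^ 3) M)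
      = T * (a ^ 2 * c * (1 - c))"
    by (simp add: T_def K_def mult_ac)
  \<comment> \<open>Here the index sum drops by one, so \<open>M\<close> stays, and
    \<open>1 - a ^ 2\<close> is the last factor of \<open>qfact (x ^ 6) i\<close>. It vanishes for
    \<open>i = 0\<close>, in agreement with the conditional. T4 works likewise with \<open>j\<close>
    and \<open>b\<close>.\<close>
  have T3: "(if i = 0 then 0 else x ^ (3 * N + m) * I_gf x m N j (i - 1))
      * (K i j * qfact (x ^ 3) M) = T * (c * (1 - a ^ 2))"
  proof (cases i)
    case 0
    then show ?thesis by (simp add: a_def)
  next
    case (Suc i')
    have e: "x ^ (3 * N + m) * x ^ closed_exp m j i' = x ^ closed_exp m i j * c"
    proof -
      have "N = i' + j + M" using N Suc by simp
      then have "3 * N + m + closed_exp m j i' = closed_exp m i j + 3 * M"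
        unfolding Suc closed_exp_Suc_left by simp
      then show ?thesis
        unfolding c_def by (simp only: power_add[symmetric])
    qed
    have "x ^ (3 * N + m) * I_gf x m N j i' * (K i j * qfact (x ^ 3) M)
        = x ^ (3 * N + m) * (I_gf x m N j i' * (K j i' * qfact (x ^ 3) M)) * (1 - a ^ 2)"
      by (simp add: Suc K_def qfact_Suc a_def pow mult_ac del: power_Suc mult_Suc_right)
    also have "\<dots> = (x ^ (3 * N + m) * x ^ closed_exp m j i') * qfact (x ^ 6) N * (1 - a ^ 2)"
    proof -
      have "N = j + i' + M" using N Suc by simp
      from IH[OF this] show ?thesis by (simp only: mult.assoc)
    qed
    finally show ?thesis
      unfolding e by (simp add: Suc T_def mult_ac)
  qed
  have T4: "(if j = 0 then 0 else x ^ (6 * N + 3 + m) * I_gf x m N i (j - 1))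
      * (K i j * qfact (x ^ 3) M) = T * (a ^ 2 * c ^ 2 * (1 - b ^ 2))"
  proof (cases j)
    case 0
    then show ?thesis by (simp add: b_def)
  next
    case (Suc j')
    have e: "x ^ (6 * N + 3 + m) * x ^ closed_exp m i j' = x ^ closed_exp m i j * (a ^ 2 * c ^ 2)"
    proof -
      have "N = i + j' + M" using N Suc by simp
      then have "6 * N + 3 + m + closed_exp m i j' = closed_exp m i j + (3 * i * 2 + 3 * M * 2)"
        unfolding Suc closed_exp_Suc_right by simp
      then show ?thesis
        unfolding a_def c_def by (simp only: power_mult[symmetric] power_add[symmetric])
    qed
    have "x ^ (6 * N + 3 + m) * I_gf x m N i j' * (K i j * qfact (x ^ 3) M)
        = x ^ (6 * N + 3 + m) * (I_gf x m N i j' * (K i j' * qfact (x ^ 3) M)) * (1 - b ^ 2)"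
      by (simp add: Suc K_def qfact_Suc b_def pow mult_ac del: power_Suc mult_Suc_right)
    also have "\<dots> = (x ^ (6 * N + 3 + m) * x ^ closed_exp m i j') * qfact (x ^ 6) N * (1 - b ^ 2)"
    proof -
      have "N = i + j' + M" using N Suc by simp
      from IH[OF this] show ?thesis by (simp only: mult.assoc)
    qed
    finally show ?thesis
      unfolding e by (simp add: Suc T_def mult_ac)
  qed
  have "I_gf x m (Suc N) i j * (K i j * qfact (x ^ 3) M)
      = T * ((1 - c) + a ^ 2 * c * (1 - c) + c * (1 - a ^ 2) + a ^ 2 * c ^ 2 * (1 - b ^ 2))"
    unfolding I_gf_Suc[OF m] distrib_right T1 T2 T3 T4 by (simp only: distrib_left)
  \<comment> \<open>All mixed terms cancel in pairs except
    \<open>a ^ 2 * b ^ 2 * c ^ 2\<close>.\<close>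
  also have "(1 - c) + a ^ 2 * c * (1 - c) + c * (1 - a ^ 2) + a ^ 2 * c ^ 2 * (1 - b ^ 2)
      = 1 - (a * b * c) ^ 2"
    by (simp add: algebra_simps power2_eq_square)
  also have "(a * b * c) ^ 2 = (x ^ 6) ^ Suc N"
    unfolding a_def b_def c_def Suc.prems pow power_add[symmetric] by (simp add: algebra_simps)
  finally show ?case
    by (simp add: K_def T_def qfact_Suc mult_ac del: power_Suc)
qed

subsection \<open>Gaussian binomials as subset sums\<close>

text \<open>This is the Gaussian binomial of \<open>N\<close> over \<open>i\<close> in base
  \<open>y\<close>, times \<open>y\<close> to the power \<open>i * (i - 1) div 2\<close>.\<close>

definition subset_gf :: "'a::comm_semiring_1 \<Rightarrow> nat \<Rightarrow> nat \<Rightarrow> 'a" where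
  "subset_gf y N i = (\<Sum>A | A \<subseteq> {..<N} \<and> card A = i. y ^ \<Sum>A)"

text \<open>The q-Pascal rule: separate the subsets according to whether they contain
  \<open>N\<close>.\<close>

lemma subset_gf_Suc:
  "subset_gf y (Suc N) i = subset_gf y N i + (if i = 0 then 0 else y ^ N * subset_gf y N (i - 1))"
proof -
  let ?F = "\<lambda>i. {A. A \<subseteq> {..<N} \<and> card A = i}"
  let ?G = "if i = 0 then {} else insert N ` ?F (i - 1)"
  have fin: "finite (?F i')" for i'
    by (rule finite_subset[of _ "Pow {..<N}"]) auto
  have sub: "finite A \<and> N \<notin> A" if "A \<subseteq> {..<N}" for A
    using that finite_subset by auto
  have "{A. A \<subseteq> {..<Suc N} \<and> card A = i} = ?F i \<union> ?G" (is "?L = ?R")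
  proof (rule set_eqI)
    fix A
    show "A \<in> ?L \<longleftrightarrow> A \<in> ?R"
    proof (cases "N \<in> A")
      case False
      then show ?thesis by (auto simp: lessThan_Suc)
    next
      case True
      then obtain B where A: "A = insert N B" "N \<notin> B" by (meson Set.set_insert)
      have 1: "A \<subseteq> {..<Suc N} \<longleftrightarrow> B \<subseteq> {..<N}"
        using A by (auto simp: lessThan_Suc)
      have 2: "A = insert N C \<longleftrightarrow> B = C" if "C \<subseteq> {..<N}" for C
        using A sub[OF that] by (simp add: insert_ident)
      show ?thesis
        using 1 2 sub[of B] A by (cases i) (auto simp: image_iff)
    qed
  qed
  moreover have "(\<Sum>A\<in>?F i \<union> ?G. y ^ \<Sum>A) = (\<Sum>A\<in>?F i. y ^ \<Sum>A) + (\<Sum>A\<in>?G. y ^ \<Sum>A)"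
    by (intro sum.union_disjoint) (auto simp: fin)
  moreover have "(\<Sum>A\<in>insert N ` ?F k. y ^ \<Sum>A) = y ^ N * (\<Sum>A\<in>?F k. y ^ \<Sum>A)" for k
  proof -
    have "inj_on (insert N) (?F k)"
      using sub by (auto simp: inj_on_def insert_ident)
    then have "(\<Sum>A\<in>insert N ` ?F k. y ^ \<Sum>A) = (\<Sum>A\<in>?F k. y ^ \<Sum>(insert N A))"
      by (simp add: sum.reindex)
    also have "\<dots> = (\<Sum>A\<in>?F k. y ^ N * y ^ \<Sum>A)"
      using sub by (intro sum.cong) (auto simp: power_add)
    finally show ?thesis by (simp add: sum_distrib_left)
  qed
  ultimately show ?thesis
    by (simp add: subset_gf_def)
qed

lemma subset_gf_0: "subset_gf y 0 i = (if i = 0 then 1 else 0)"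
proof -
  have "{A. A \<subseteq> {..<0::nat} \<and> card A = i} = (if i = 0 then {{}} else {})"
    by auto
  then show ?thesis by (simp add: subset_gf_def)
qed

lemma subset_gf_eq_0: "N < i \<Longrightarrow> subset_gf y N i = 0"
  by (induction N arbitrary: i) (auto simp: subset_gf_0 subset_gf_Suc)

text \<open>The base is a square so that the exponent \<open>i * (i - 1)\<close> need not be halved.
  The two terms of the q-Pascal rule contribute \<open>1 - y ^ L\<close> and
  \<open>y ^ L * (1 - y ^ i)\<close>, whose sum is the new factor
  \<open>1 - y ^ Suc N\<close>.\<close>

lemma subset_gf_closed_form:
  fixes w :: "'a::idom"
  assumes "N = i + L"
  shows "subset_gf (w ^ 2) N i * (qfact (w ^ 2) i * qfact (w ^ 2) L)
    = w ^ (i * (i - 1)) * qfact (w ^ 2) N"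
  using assms
proof (induction N arbitrary: i L)
  case 0
  then show ?case by (simp add: subset_gf_0)
next
  case (Suc N)
  define y where "y = w ^ 2"
  define T where "T = w ^ (i * (i - 1)) * qfact y N"
  have IH: "subset_gf y N i' * (qfact y i' * qfact y L') = w ^ (i' * (i' - 1)) * qfact y N"
    if "N = i' + L'" for i' L'
    using Suc.IH[OF that] by (simp add: y_def)
  have T1: "subset_gf y N i * (qfact y i * qfact y L) = T * (1 - y ^ L)"
  proof (cases L)
    case 0
    then show ?thesis
      using Suc.prems by (simp add: subset_gf_eq_0)
  next
    case (Suc L')
    then have "N = i + L'" using Suc.prems by simp
    from IH[OF this] show ?thesis
      by (simp add: T_def Suc qfact_Suc mult.assoc[symmetric] del: power_Suc)
  qed
  have T2: "(if i = 0 then 0 else y ^ N * subset_gf y N (i - 1)) * (qfact y i * qfact y L)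
      = T * (y ^ L * (1 - y ^ i))"
  proof (cases i)
    case 0
    then show ?thesis by simp
  next
    case (Suc i')
    then have N: "N = i' + L" using Suc.prems by simp
    have "2 * N + i' * (i' - 1) = i * (i - 1) + 2 * L"
      unfolding N Suc by (cases i') simp_all
    then have e: "y ^ N * w ^ (i' * (i' - 1)) = w ^ (i * (i - 1)) * y ^ L"
      unfolding y_def by (simp only: power_mult[symmetric] power_add[symmetric])
    have "y ^ N * subset_gf y N i' * (qfact y i * qfact y L)
        = y ^ N * (subset_gf y N i' * (qfact y i' * qfact y L)) * (1 - y ^ i)"
      by (simp add: Suc qfact_Suc mult_ac del: power_Suc)
    also have "\<dots> = (y ^ N * w ^ (i' * (i' - 1))) * qfact y N * (1 - y ^ i)"
      by (simp only: IH[OF N] mult.assoc)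
    finally show ?thesis
      unfolding e by (simp add: Suc T_def mult_ac del: power_Suc)
  qed
  have "subset_gf y (Suc N) i * (qfact y i * qfact y L) = T * ((1 - y ^ L) + y ^ L * (1 - y ^ i))"
    unfolding subset_gf_Suc distrib_right T1 T2 by (simp only: distrib_left)
  also have "(1 - y ^ L) + y ^ L * (1 - y ^ i) = 1 - y ^ Suc N"
    unfolding Suc.prems by (simp add: algebra_simps power_add)
  finally show ?case
    unfolding y_def[symmetric] by (simp add: T_def qfact_Suc mult_ac del: power_Suc)
qed

subsection \<open>The closed form for side II\<close>

text \<open>The conditions of side II ignore the order of the parts, so sets can replace lists; the
  sum is left free for the generating function.\<close>

definition II_sets :: "nat \<Rightarrow> nat \<Rightarrow> nat \<Rightarrow> nat \<Rightarrow> nat set set" where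
  "II_sets m N i j = {S. 0 \<notin> S \<and> (\<forall>p\<in>S. \<not> [int p = - int m] (mod 3)) \<and>
     card {p \<in> S. [p = m] (mod 6)} = i \<and>
     (\<forall>p\<in>S. [p = m] (mod 6) \<longrightarrow> int p \<le> 6 * int N + int m - 6) \<and>
     card {p \<in> S. [p = m + 3] (mod 6)} = j \<and>
     (\<forall>p\<in>S. [p = m + 3] (mod 6) \<longrightarrow> int p \<le> 6 * (int N - int i) + int m - 3) \<and>
     (\<forall>p\<in>S. [p = 0] (mod 3) \<longrightarrow> int p \<le> 3 * (int N - int i - int j))}"

text \<open>Indices start at 0, so the bounds of side II become \<open>k < N\<close>,
  \<open>k < N - i\<close> and \<open>k < N - i - j\<close>. The shift in \<open>3 * k + 3\<close>
  keeps 0 out.\<close>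

definition encode :: "nat \<Rightarrow> nat set \<times> nat set \<times> nat set \<Rightarrow> nat set" where
  "encode m = (\<lambda>(A, B, C). (\<lambda>k. 6 * k + m) ` A \<union> (\<lambda>k. 6 * k + (m + 3)) ` B \<union> (\<lambda>k. 3 * k + 3) ` C)"

definition decode :: "nat \<Rightarrow> nat set \<Rightarrow> nat set \<times> nat set \<times> nat set" where
  "decode m S = ({k. 6 * k + m \<in> S}, {k. 6 * k + (m + 3) \<in> S}, {k. 3 * k + 3 \<in> S})"

text \<open>When \<open>i + j > N\<close> the truncated subtractions do no harm: one of the first two factors is
  already empty.\<close>

definition triples :: "nat \<Rightarrow> nat \<Rightarrow> nat \<Rightarrow> (nat set \<times> nat set \<times> nat set) set" where
  "triples N i j = {A. A \<subseteq> {..<N} \<and> card A = i} \<times> {B. B \<subseteq> {..<N - i} \<and> card B = j}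
     \<times> Pow {..<N - i - j}"

text \<open>The three progressions are pairwise disjoint modulo 6, so each component can be read off
  from the union.\<close>

lemma mem_encode:
  assumes "m \<in> {1, 2}"
  shows "6 * k + m \<in> encode m (A, B, C) \<longleftrightarrow> k \<in> A"
    and "6 * k + (m + 3) \<in> encode m (A, B, C) \<longleftrightarrow> k \<in> B"
    and "3 * k + 3 \<in> encode m (A, B, C) \<longleftrightarrow> k \<in> C"
proof -
  have ne: "6 * k + m \<noteq> 6 * l + (m + 3)" "6 * k + m \<noteq> 3 * l + 3" "6 * k + (m + 3) \<noteq> 3 * l + 3" for k l :: nat
    using assms by (auto; presburger)+
  show "6 * k + m \<in> encode m (A, B, C) \<longleftrightarrow> k \<in> A"
    using ne(1)[of k] ne(2)[of k] by (auto simp: encode_def)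
  show "6 * k + (m + 3) \<in> encode m (A, B, C) \<longleftrightarrow> k \<in> B"
    using ne(1)[of _ k] ne(3)[of k] by (force simp: encode_def)
  show "3 * k + 3 \<in> encode m (A, B, C) \<longleftrightarrow> k \<in> C"
    using ne(2)[of _ k] ne(3)[of _ k] by (force simp: encode_def)
qed

lemma decode_encode: "m \<in> {1, 2} \<Longrightarrow> decode m (encode m T) = T"
  by (cases T) (simp add: decode_def mem_encode)

lemma residue_cases:
  assumes "p mod 3 = 0 \<or> p mod 3 = m" "0 < (p :: nat)"
  obtains k where "p = 6 * k + m" | k where "p = 6 * k + (m + 3)" | k where "p = 3 * k + 3"
proof (cases "p mod 3 = 0")
  case True
  then obtain l where "p = 3 * l" by (meson mod_0_imp_dvd dvdE)
  \<comment> \<open>Positivity of \<open>p\<close> gives \<open>0 < l\<close>, so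
    \<open>l - 1\<close> does not truncate.\<close>
  with assms(2) have "p = 3 * (l - 1) + 3" by simp
  then show thesis by (rule that(3))
next
  case False
  then have p: "p = 3 * (p div 3) + m" using assms(1) div_mult_mod_eq[of p 3] by simp
  show thesis
  proof (cases "even (p div 3)")
    case True
    then obtain k where "p div 3 = 2 * k" by (rule evenE)
    with p have "p = 6 * k + m" by simp
    then show thesis by (rule that(1))
  next
    case False
    then obtain k where "p div 3 = 2 * k + 1" by (rule oddE)
    with p have "p = 6 * k + (m + 3)" by simp
    then show thesis by (rule that(2))
  qed
qed

lemma encode_decode:
  assumes m: "m \<in> {1, 2}" and "0 \<notin> S" and "\<forall>p\<in>S. \<not> [int p = - int m] (mod 3)"
  shows "encode m (decode m S) = S"
proof (rule set_eqI)
  fix p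
  show "p \<in> encode m (decode m S) \<longleftrightarrow> p \<in> S"
  proof
    show "p \<in> S" if "p \<in> encode m (decode m S)"
      using that by (auto simp: encode_def decode_def)
    assume "p \<in> S"
    then have "0 < p" "p mod 3 = 0 \<or> p mod 3 = m"
      using assms(2,3) part_residue[OF m] by (metis gr0I, blast)
    then show "p \<in> encode m (decode m S)"
      using \<open>p \<in> S\<close> m by (elim residue_cases[rotated]) (auto simp: encode_def decode_def)
  qed
qed

text \<open>Each count or bound concerns a single residue class and therefore a single component of
  the triple.\<close>

lemma II_sets_iff:
  assumes m: "m \<in> {1, 2}" and S: "S = encode m T"
  shows "S \<in> II_sets m N i j \<longleftrightarrow> T \<in> triples N i j"
proof -
  obtain A B C where T: "T = (A, B, C)" by (cases T)
  have c1: "[6 * k + m = m] (mod 6)" "\<not> [6 * k + (m + 3) = m] (mod 6)" "\<not> [3 * k + 3 = m] (mod 6)" for k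
    using m by (auto simp: cong_def; presburger)+
  have c2: "\<not> [6 * k + m = m + 3] (mod 6)" "[6 * k + (m + 3) = m + 3] (mod 6)" "\<not> [3 * k + 3 = m + 3] (mod 6)" for k
    using m by (auto simp: cong_def; presburger)+
  have c3: "\<not> [6 * k + m = 0] (mod 3)" "\<not> [6 * k + (m + 3) = 0] (mod 3)" "[3 * k + 3 = 0] (mod 3)" for k
    using m by (auto simp: cong_def; presburger)+
  have "card {p \<in> S. [p = m] (mod 6)} = card ((\<lambda>k. 6 * k + m) ` A)"
    by (rule arg_cong[where f = card]) (auto simp: S T encode_def c1)
  then have A: "card {p \<in> S. [p = m] (mod 6)} = card A"
    by (simp add: card_image inj_on_def)
  have "card {p \<in> S. [p = m + 3] (mod 6)} = card ((\<lambda>k. 6 * k + (m + 3)) ` B)"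
    unfolding S T encode_def by (rule arg_cong[where f = card]) (use c2 in blast)
  then have B: "card {p \<in> S. [p = m + 3] (mod 6)} = card B"
    by (simp add: card_image inj_on_def)
  have r: "\<forall>p\<in>S. \<not> [int p = - int m] (mod 3)"
  proof
    fix p assume "p \<in> S"
    then have "p mod 3 = 0 \<or> p mod 3 = m"
      using m unfolding S T encode_def by (auto; presburger)
    then show "\<not> [int p = - int m] (mod 3)"
      by (simp only: part_residue[OF m])
  qed
  have "(\<forall>p\<in>S. [p = m] (mod 6) \<longrightarrow> int p \<le> 6 * int N + int m - 6)
      \<longleftrightarrow> (\<forall>k\<in>A. int (6 * k + m) \<le> 6 * int N + int m - 6)"
    by (simp only: S T encode_def prod.case ball_Un ball_simps c1 simp_thms ball_triv)
  also have "\<dots> \<longleftrightarrow> A \<subseteq> {..<N}"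
    by (auto simp: subset_iff)
  finally have bA: "(\<forall>p\<in>S. [p = m] (mod 6) \<longrightarrow> int p \<le> 6 * int N + int m - 6) \<longleftrightarrow> A \<subseteq> {..<N}" .
  have "(\<forall>p\<in>S. [p = m + 3] (mod 6) \<longrightarrow> int p \<le> 6 * (int N - int i) + int m - 3)
      \<longleftrightarrow> (\<forall>k\<in>B. int (6 * k + (m + 3)) \<le> 6 * (int N - int i) + int m - 3)"
    by (simp only: S T encode_def prod.case ball_Un ball_simps c2 simp_thms ball_triv)
  \<comment> \<open>If \<open>N < i\<close>, the integer bound excludes every \<open>k\<close>, just
    as the truncated \<open>N - i = 0\<close> does.\<close>
  also have "\<dots> \<longleftrightarrow> B \<subseteq> {..<N - i}"
    unfolding subset_iff lessThan_iff Ball_def by (intro all_cong1 imp_cong refl) arith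
  finally have bB: "(\<forall>p\<in>S. [p = m + 3] (mod 6) \<longrightarrow> int p \<le> 6 * (int N - int i) + int m - 3)
      \<longleftrightarrow> B \<subseteq> {..<N - i}" .
  have "(\<forall>p\<in>S. [p = 0] (mod 3) \<longrightarrow> int p \<le> 3 * (int N - int i - int j))
      \<longleftrightarrow> (\<forall>k\<in>C. int (3 * k + 3) \<le> 3 * (int N - int i - int j))"
    by (simp only: S T encode_def prod.case ball_Un ball_simps c3 simp_thms ball_triv)
  also have "\<dots> \<longleftrightarrow> C \<subseteq> {..<N - i - j}"
    unfolding subset_iff lessThan_iff Ball_def by (intro all_cong1 imp_cong refl) arith
  finally have bC: "(\<forall>p\<in>S. [p = 0] (mod 3) \<longrightarrow> int p \<le> 3 * (int N - int i - int j))
      \<longleftrightarrow> C \<subseteq> {..<N - i - j}" .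
  have "0 \<notin> S"
    using m by (auto simp: S T encode_def)
  then show ?thesis
    unfolding II_sets_def triples_def T mem_Collect_eq A B bA bB bC using r by auto
qed

lemma II_sets_decode:
  assumes "m \<in> {1, 2}" "S \<in> II_sets m N i j"
  shows "encode m (decode m S) = S" and "decode m S \<in> triples N i j"
proof -
  show 1: "encode m (decode m S) = S"
    using assms by (intro encode_decode) (auto simp: II_sets_def)
  show "decode m S \<in> triples N i j"
    using II_sets_iff[OF assms(1) 1[symmetric]] assms(2) by blast
qed

section \<open>The generating function of side II as a product\<close>

lemma sum_encode:
  assumes m: "m \<in> {1, 2}" and "(A, B, C) \<in> triples N i j"
  shows "\<Sum>(encode m (A, B, C)) = (m * i + (m + 3) * j) + 6 * \<Sum>A + 6 * \<Sum>B + (\<Sum>k\<in>C. 3 * k + 3)"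
proof -
  have fin: "finite A" "finite B" "finite C" and card: "card A = i" "card B = j"
    using assms(2) by (auto simp: triples_def intro: finite_subset)
  have ne: "6 * k + m \<noteq> 6 * l + (m + 3)" "6 * k + m \<noteq> 3 * l + 3" "6 * k + (m + 3) \<noteq> 3 * l + 3" for k l :: nat
    using assms by (auto; presburger)+
  have "\<Sum>(encode m (A, B, C)) = \<Sum>((\<lambda>k. 6 * k + m) ` A) + \<Sum>((\<lambda>k. 6 * k + (m + 3)) ` B)
      + \<Sum>((\<lambda>k. 3 * k + 3) ` C)"
    unfolding encode_def prod.case
    apply (subst sum.union_disjoint)
    subgoal using fin by blast
    subgoal using fin by blast
    subgoal using ne by blast
    apply (subst sum.union_disjoint)
    subgoal using fin by blast
    subgoal using fin by blast
    subgoal using ne by blast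
    by simp
  also have "\<dots> = (\<Sum>k\<in>A. 6 * k + m) + (\<Sum>k\<in>B. 6 * k + (m + 3)) + (\<Sum>k\<in>C. 3 * k + 3)"
    by (simp add: sum.reindex inj_on_def)
  also have "\<dots> = (m * i + (m + 3) * j) + 6 * \<Sum>A + 6 * \<Sum>B + (\<Sum>k\<in>C. 3 * k + 3)"
    unfolding sum.distrib[of "\<lambda>k. 6 * k"] by (simp add: card sum_distrib_left)
  finally show ?thesis .
qed

text \<open>Expand the product: \<open>C\<close> collects the factors from which the power of
  \<open>x\<close> is chosen.\<close>

lemma sum_Pow_power:
  fixes x :: "'a::comm_ring_1"
  shows "(\<Sum>C\<in>Pow {..<M}. x ^ (\<Sum>k\<in>C. 3 * k + 3)) = (\<Prod>k<M. 1 + (x ^ 3) ^ Suc k)"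
proof -
  have "(\<Prod>k<M. (x ^ 3) ^ Suc k + 1) = (\<Sum>C\<in>Pow {..<M}. \<Prod>k\<in>C. (x ^ 3) ^ Suc k)"
    by (subst prod_add) simp_all
  also have "\<dots> = (\<Sum>C\<in>Pow {..<M}. x ^ (\<Sum>k\<in>C. 3 * k + 3))"
    by (simp add: power_sum power_mult[symmetric] algebra_simps del: power_Suc)
  finally show ?thesis by (simp add: add.commute)
qed

lemma II_sets_gf:
  fixes x :: "'a::idom"
  assumes m: "m \<in> {1, 2}"
  shows "(\<Sum>S\<in>II_sets m N i j. x ^ \<Sum>S) = x ^ (m * i + (m + 3) * j) * subset_gf (x ^ 6) N i
    * subset_gf (x ^ 6) (N - i) j * (\<Prod>k<N - i - j. 1 + (x ^ 3) ^ Suc k)"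
proof -
  let ?h = "\<lambda>(A, B, C). x ^ (m * i + (m + 3) * j) * ((x ^ 6) ^ \<Sum>A * ((x ^ 6) ^ \<Sum>B * x ^ (\<Sum>k\<in>C. 3 * k + 3)))"
  have "(\<Sum>S\<in>II_sets m N i j. x ^ \<Sum>S) = (\<Sum>T\<in>triples N i j. ?h T)"
  proof (rule sum.reindex_bij_witness[of _ "encode m" "decode m"])
    fix S assume S: "S \<in> II_sets m N i j"
    obtain A B C where d: "decode m S = (A, B, C)" by (cases "decode m S")
    have "(A, B, C) \<in> triples N i j" "encode m (A, B, C) = S"
      using II_sets_decode[OF m S] d by auto
    then have "\<Sum>S = (m * i + (m + 3) * j) + 6 * \<Sum>A + 6 * \<Sum>B + (\<Sum>k\<in>C. 3 * k + 3)"
      using sum_encode[OF m] by blast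
    then show "?h (decode m S) = x ^ \<Sum>S"
      by (simp only: d prod.case power_add power_mult mult.assoc)
  qed (use II_sets_decode[OF m] decode_encode[OF m] II_sets_iff[OF m refl] in auto)
  also have "\<dots> = x ^ (m * i + (m + 3) * j) * (subset_gf (x ^ 6) N i
    * (subset_gf (x ^ 6) (N - i) j * (\<Sum>C\<in>Pow {..<N - i - j}. x ^ (\<Sum>k\<in>C. 3 * k + 3))))"
    unfolding triples_def subset_gf_def
    by (simp only: sum.cartesian_product' prod.case sum_distrib_left[symmetric]
        sum_distrib_right[symmetric])
  finally show ?thesis
    by (simp only: sum_Pow_power mult.assoc)
qed

text \<open>The factor \<open>qfact (x ^ 6) (j + M)\<close> cancels between the two Gaussian
  binomials, and \<open>?P\<close> turns \<open>qfact (x ^ 3) M\<close> into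
  \<open>qfact (x ^ 6) M\<close>. What remains is the right-hand side of
  \<open>I_gf_closed_form\<close>.\<close>

lemma II_sets_gf_closed_form:
  fixes x :: "'a::idom"
  assumes m: "m \<in> {1, 2}" and N: "N = i + j + M"
  shows "(\<Sum>S\<in>II_sets m N i j. x ^ \<Sum>S) * (qfact (x ^ 6) i * qfact (x ^ 6) j * qfact (x ^ 3) M)
    = x ^ closed_exp m i j * qfact (x ^ 6) N"
proof -
  let ?P = "\<Prod>k<M. 1 + (x ^ 3) ^ Suc k"
  define E where "E = x ^ (m * i + (m + 3) * j)"
  have 6: "x ^ 6 = (x ^ 3) ^ 2"
    by (simp flip: power_mult)
  have M: "N - i = j + M" "j + M - j = M" using N by auto
  have P: "qfact (x ^ 3) M * ?P = qfact (x ^ 6) M"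
    unfolding 6 by (rule qfact_square[symmetric])
  have c1: "subset_gf (x ^ 6) N i * (qfact (x ^ 6) i * qfact (x ^ 6) (j + M))
      = (x ^ 3) ^ (i * (i - 1)) * qfact (x ^ 6) N"
    unfolding 6 using N by (intro subset_gf_closed_form) simp
  have c2: "subset_gf (x ^ 6) (j + M) j * (qfact (x ^ 6) j * qfact (x ^ 6) M)
      = (x ^ 3) ^ (j * (j - 1)) * qfact (x ^ 6) (j + M)"
    unfolding 6 by (rule subset_gf_closed_form) simp
  have "(\<Sum>S\<in>II_sets m N i j. x ^ \<Sum>S) * (qfact (x ^ 6) i * qfact (x ^ 6) j * qfact (x ^ 3) M)
      = E * subset_gf (x ^ 6) N i * qfact (x ^ 6) i
        * (subset_gf (x ^ 6) (j + M) j * (qfact (x ^ 6) j * (qfact (x ^ 3) M * ?P)))"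
    unfolding II_sets_gf[OF m] M E_def[symmetric] by (simp only: mult_ac)
  also have "\<dots> = E * (x ^ 3) ^ (j * (j - 1))
        * (subset_gf (x ^ 6) N i * (qfact (x ^ 6) i * qfact (x ^ 6) (j + M)))"
    unfolding P c2 by (simp only: mult_ac)
  also have "\<dots> = (E * (x ^ 3) ^ (j * (j - 1)) * (x ^ 3) ^ (i * (i - 1))) * qfact (x ^ 6) N"
    unfolding c1 by (simp only: mult.assoc)
  also have "E * (x ^ 3) ^ (j * (j - 1)) * (x ^ 3) ^ (i * (i - 1)) = x ^ closed_exp m i j"
    unfolding E_def power_mult[symmetric] power_add[symmetric] closed_exp_def
    by (rule arg_cong[where f = "power x"]) (cases j; simp add: algebra_simps)
  finally show ?thesis .
qed

section \<open>Equality of the two generating functions\<close>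

lemma I_gf_eq_II_sets_gf:
  fixes x :: "'a::idom"
  assumes m: "m \<in> {1, 2}" and x: "\<And>k. 0 < k \<Longrightarrow> x ^ k \<noteq> 1"
  shows "I_gf x m N i j = (\<Sum>S\<in>II_sets m N i j. x ^ \<Sum>S)"
proof (cases "i + j \<le> N")
  case True
  then obtain M where N: "N = i + j + M" using le_Suc_ex by blast
  have "(x ^ 6) ^ k \<noteq> 1" "(x ^ 3) ^ k \<noteq> 1" if "0 < k" for k
    using x[of "6 * k"] x[of "3 * k"] that by (simp_all add: power_mult)
  then have "qfact (x ^ 6) i * qfact (x ^ 6) j * qfact (x ^ 3) M \<noteq> 0"
    by (simp add: qfact_nonzero)
  then show ?thesis
    using I_gf_closed_form[OF m N, of x] II_sets_gf_closed_form[OF m N, of x]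
    by (metis mult_right_cancel)
next
  case False
  then have "N < i \<or> N - i < j" by linarith
  then show ?thesis
    using False by (auto simp: I_gf_eq_0[OF m] II_sets_gf[OF m] subset_gf_eq_0)
qed

text \<open>A crude common bound, from which finiteness on side II follows.\<close>

lemma II_sets_bounded:
  assumes m: "m \<in> {1, 2}" and "S \<in> II_sets m N i j"
  shows "S \<subseteq> {..6 * N + 6}"
proof -
  obtain A B C where T: "decode m S = (A, B, C)" by (cases "decode m S")
  then have "A \<subseteq> {..<N}" "B \<subseteq> {..<N - i}" "C \<subseteq> {..<N - i - j}"
    using II_sets_decode(2)[OF assms] by (auto simp: triples_def)
  then have "encode m (A, B, C) \<subseteq> {..6 * N + 6}"
    using m by (fastforce simp: encode_def)
  then show ?thesis
    using II_sets_decode(1)[OF assms] T by simp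
qed

text \<open>A finite set of naturals has exactly one strictly decreasing enumeration.\<close>

lemma list_gf_sets:
  assumes "\<And>S. S \<in> F \<Longrightarrow> finite S"
  shows "list_gf x {\<pi>. sorted_wrt (>) \<pi> \<and> set \<pi> \<in> F} = (\<Sum>S\<in>F. x ^ \<Sum>S)"
  unfolding list_gf_def
proof (rule sum.reindex_bij_witness[of _ "\<lambda>S. rev (sorted_list_of_set S)" set])
  fix \<pi> :: "nat list" assume "\<pi> \<in> {\<pi>. sorted_wrt (>) \<pi> \<and> set \<pi> \<in> F}"
  then have \<pi>: "sorted_wrt (>) \<pi>" "set \<pi> \<in> F" by auto
  then have "sorted_wrt (<) (rev \<pi>)"
    by (simp add: sorted_wrt_rev)
  then have "sorted_list_of_set (set (rev \<pi>)) = rev \<pi>"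
    by (metis sorted_list_of_set.idem_if_sorted_distinct strict_sorted_iff)
  then show "rev (sorted_list_of_set (set \<pi>)) = \<pi>"
    by simp
  show "set \<pi> \<in> F" by fact
  show "x ^ \<Sum>(set \<pi>) = x ^ sum_list \<pi>"
    using distinct_if_sorted_wrt_greater[OF \<pi>(1)] by (simp add: distinct_sum_list_conv_Sum)
qed (auto simp: assms sorted_wrt_rev)

subsection \<open>Comparing coefficients\<close>

lemma coeff_list_gf:
  assumes "finite A"
  shows "coeff (list_gf (monom (1 :: int) 1) A) n = int (card {\<pi> \<in> A. sum_list \<pi> = n})"
proof -
  have "coeff (list_gf (monom (1 :: int) 1) A) n = (\<Sum>\<pi>\<in>A. if sum_list \<pi> = n then 1 else 0)"
    by (simp add: list_gf_def coeff_sum monom_power)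
  also have "\<dots> = int (card {\<pi> \<in> A. sum_list \<pi> = n})"
    using assms by (simp add: sum.If_cases Int_def)
  finally show ?thesis .
qed

theorem theorem3p13:
  fixes m N i j n :: nat
  assumes "m \<in> {1, 2}"
  shows "D_I m N i j n = D_II m N i j n"
proof -
  let ?I = "decreasing_lists (I_parts m N) (\<lambda>p. [p = m] (mod 3)) i j"
  let ?II = "{\<pi>. sorted_wrt (>) \<pi> \<and> set \<pi> \<in> II_sets m N i j}"
  let ?x = "monom (1 :: int) 1"
  have finI: "finite ?I"
    by (rule finite_decreasing_lists, rule finite_subset[of _ "{..3 * N}"]) (auto simp: I_parts_def)
  have finII: "finite ?II"
    by (rule finite_subset[OF _ finite_sorted_lists[of "{..6 * N + 6}"]])
      (use II_sets_bounded[OF assms, of _ N i j] in blast)+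
  have "list_gf ?x ?I = list_gf ?x ?II"
  proof -
    \<comment> \<open>The indeterminate of the integer polynomials is not a root of unity, so the
      cancellation is legitimate.\<close>
    have "?x ^ k \<noteq> 1" if "0 < k" for k
      using that by (simp add: monom_power monom_eq_1_iff)
    then have "list_gf ?x ?I = (\<Sum>S\<in>II_sets m N i j. ?x ^ \<Sum>S)"
      unfolding I_gf_def[symmetric] by (rule I_gf_eq_II_sets_gf[OF assms])
    also have "\<dots> = list_gf ?x ?II"
      by (rule list_gf_sets[symmetric], rule finite_subset[OF II_sets_bounded[OF assms]]) simp_all
    finally show ?thesis .
  qed
  then have "card {\<pi> \<in> ?I. sum_list \<pi> = n} = card {\<pi> \<in> ?II. sum_list \<pi> = n}"
    using coeff_list_gf[OF finI, of n] coeff_list_gf[OF finII, of n] by simp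
  moreover have "{\<pi> \<in> ?I. sum_list \<pi> = n} = {\<pi> \<in> distinct_partitions n.
     (\<forall>p\<in>set \<pi>. \<not> [int p = - int m] (mod 3)) \<and>
     (\<forall>p\<in>set \<pi>. p \<le> 3 * N) \<and>
     odd_indexed_count \<pi> (\<lambda>p. [p = m] (mod 3)) = i \<and>
     even_indexed_count \<pi> (\<lambda>p. [p = m] (mod 3)) = j}"
    unfolding decreasing_lists_def I_parts_def distinct_partitions_def by blast
  moreover have "{\<pi> \<in> ?II. sum_list \<pi> = n} = {\<pi> \<in> distinct_partitions n.
     (\<forall>p\<in>set \<pi>. \<not> [int p = - int m] (mod 3)) \<and>
     card {p \<in> set \<pi>. [p = m] (mod 6)} = i \<and>
     (\<forall>p\<in>set \<pi>. [p = m] (mod 6) \<longrightarrow> int p \<le> 6 * int N + int m - 6) \<and>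
     card {p \<in> set \<pi>. [p = m + 3] (mod 6)} = j \<and>
     (\<forall>p\<in>set \<pi>. [p = m + 3] (mod 6) \<longrightarrow> int p \<le> 6 * (int N - int i) + int m - 3) \<and>
     (\<forall>p\<in>set \<pi>. [p = 0] (mod 3) \<longrightarrow> int p \<le> 3 * (int N - int i - int j))}"
    unfolding II_sets_def distinct_partitions_def by (auto intro: gr0I)
  ultimately show ?thesis
    by (simp only: D_I_def D_II_def)
qed

end
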